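(* Let $\alpha,\beta\in\mathbb{R}$ be such that $1,\alpha,\beta$ are linearly independent over $\mathbb{Q}$, let $(t_n)_{n=1}^\infty$ be an $\alpha\beta$-orbit, and let $J\subseteq\mathbb{N}$ be a set with $\underline{d}(J)<1$. Then $\dim_A\{t_n\mid n\in\mathbb{N}\setminus J\}\geq 1/4$.
   Context: An (infinite) $\alpha\beta$-orbit is a sequence $(t_n)_{n=1}^\infty\subseteq\mathbb{R}/\mathbb{Z}$ with $t_{n+1}-t_n\in\{\alpha,\beta\}$ (mod $1$) for all $n$. For $J\subseteq\mathbb{N}$ the lower density is $\underline{d}(J)=\liminf_{N\to\infty}\frac1N|J\cap\{1,\ldots,N\}|$. For a set $E$, let $N(E,\rho)$ be the minimal number of intervals of length $\rho$ needed to cover $E$. The Assouad dimension of $E\subseteq\mathbb{R}$ is $$\dim_A E=\limsup_{\delta\to 0}\ \sup\left\{\frac{\log N(E\cap I,\delta|I|)}{\log(1/\delta)}\ \middle|\ I\subseteq\mathbb{R}\text{ an interval}\right\},$$ where $|I|$ is the length of $I$; subsets of $\mathbb{R}/\mathbb{Z}$ are identified with subsets of $[0,1)$. *)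

theory Defs
  imports "HOL-Analysis.Analysis" "HOL-Library.Real_Mod"
begin

text \<open>
  The circle \<open>\<real>/\<int>\<close> is represented by the fundamental domain \<open>[0,1)\<close>, with congruence
  taken modulo 1. Sequences are indexed from 1; the value at index 0 is irrelevant.
\<close>

definition alpha_beta_orbit :: "real \<Rightarrow> real \<Rightarrow> (nat \<Rightarrow> real) \<Rightarrow> bool" where
  "alpha_beta_orbit \<alpha> \<beta> t \<longleftrightarrow>
     (\<forall>n\<ge>1. t n \<in> {0..<1}) \<and>
     (\<forall>n\<ge>1. [t (Suc n) - t n = \<alpha>] (rmod 1) \<or> [t (Suc n) - t n = \<beta>] (rmod 1))"

text \<open>Linear independence of the \<^emph>\<open>family\<close> \<open>1, \<alpha>, \<beta>\<close>: the library notion concerns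
  sets, so distinctness has to be required separately.\<close>

definition rat_independent_with_1 :: "real \<Rightarrow> real \<Rightarrow> bool" where
  "rat_independent_with_1 \<alpha> \<beta> \<longleftrightarrow>
     distinct [1, \<alpha>, \<beta>] \<and>
     module.independent (\<lambda>(q :: rat) (x :: real). of_rat q * x) {1, \<alpha>, \<beta>}"

definition lower_density :: "nat set \<Rightarrow> ereal" where
  "lower_density J = liminf (\<lambda>N. ereal (real (card (J \<inter> {1..N})) / real N))"

text \<open>Open, closed and half-open intervals are all admitted.\<close>

definition interval_of_length :: "real \<Rightarrow> real set \<Rightarrow> bool" where
  "interval_of_length l I \<longleftrightarrow> is_interval I \<and> bounded I \<and> measure lborel I = l"

text \<open>The least number of intervals of length \<open>\<rho>\<close> covering \<open>E\<close>; it is only used for bounded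
  \<open>E\<close> and \<open>\<rho> > 0\<close>, where a finite cover exists.\<close>

definition covering_number :: "real set \<Rightarrow> real \<Rightarrow> nat" where
  "covering_number E \<rho> =
     (LEAST k. \<exists>\<C>. finite \<C> \<and> card \<C> = k \<and>
        (\<forall>C\<in>\<C>. interval_of_length \<rho> C) \<and> E \<subseteq> \<Union>\<C>)"

text \<open>The supremum is over bounded intervals of positive length. Since \<open>ln 0 = 0\<close>, intervals
  missing \<open>E\<close> contribute 0; for nonempty \<open>E\<close> this does not affect the supremum, which is
  then nonnegative anyway.\<close>

definition assouad_dim :: "real set \<Rightarrow> ereal" where
  "assouad_dim E =
     Limsup (at_right 0) (\<lambda>\<delta>.
       SUP I \<in> {I. \<exists>l>0. interval_of_length l I}.
         ereal (ln (real (covering_number (E \<inter> I) (\<delta> * measure lborel I))) / ln (1 / \<delta>)))"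

end

theory Submission
  imports Defs
begin

text \<open>
  Put \<open>\<gamma> = \<beta> - \<alpha>\<close> and \<open>L(k,j,m) = k\<alpha> + j\<gamma> - m\<close>. Differences of orbit points are values of \<open>L\<close> with
  \<open>0 \<le> j \<le> k\<close>. Let \<open>X\<^sub>i = (q\<^sub>i,j\<^sub>i,m\<^sub>i)\<close> be the successive best approximations, i.e. the record
  minima \<open>\<delta>\<^sub>i = \<bar>L(X\<^sub>i)\<bar>\<close>, and suppose the dimension is less than 1/4. Orbit points in a time
  window of length \<open>q\<^sub>i\<^sub>+\<^sub>1\<close> are \<open>\<delta>\<^sub>i\<close>-separated, so \<open>\<delta>\<^sub>i = O(q\<^sub>i\<^sub>+\<^sub>1\<^sup>-\<^sup>4)\<close>. Three consecutive \<open>X\<^sub>i\<close> are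
  linearly independent infinitely often. For such a triple \<open>X\<^sub>0, X\<^sub>1, X\<^sub>2\<close>, an integrality argument
  for determinants shows that every difference of size at most \<open>\<delta>\<^sub>0/4q\<^sub>1\<^sup>2\<close> between points of a time
  window of length \<open>T \<approx> 1/(\<delta>\<^sub>0q\<^sub>1)\<close> is a rational multiple of \<open>L(X\<^sub>1)\<close>. Since the set of times has
  positive density in some window of length \<open>T\<close>, the pigeonhole principle produces many
  \<open>\<delta>\<^sub>1\<close>-separated points in an interval of length \<open>\<delta>\<^sub>1T/q\<^sub>1\<close>; at this location and scale the covering
  numbers are too large.
\<close>

subsection \<open>Covering numbers\<close>

lemma interval_of_length_Icc: "a \<le> b \<Longrightarrow> interval_of_length (b - a) {a..b}"
  by (simp add: interval_of_length_def is_interval_cc)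

lemma interval_of_length_diff_le:
  assumes "interval_of_length l C" "x \<in> C" "y \<in> C"
  shows "\<bar>x - y\<bar> \<le> l"
proof -
  have le: "v - u \<le> l" if "u \<in> C" "v \<in> C" for u v
  proof (cases "u \<le> v")
    case True
    have C: "is_interval C" "bounded C" "measure lborel C = l"
      using assms(1) by (auto simp: interval_of_length_def)
    have "{u..v} \<subseteq> C"
      using mem_is_interval_1_I[OF C(1) that(1,2)] by auto
    moreover have "C \<in> fmeasurable lborel"
      using C emeasure_bounded_finite[of C]
      by (simp add: fmeasurable_def real_interval_borel_measurable)
    ultimately have "measure lborel {u..v} \<le> measure lborel C"
      by (intro measure_mono_fmeasurable) auto
    then show ?thesis using True C(3) by simp
  next
    case False
    then have "v - u \<le> 0" by simp
    also have "0 \<le> l" using assms(1) by (auto simp: interval_of_length_def)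
    finally show ?thesis .
  qed
  from le[OF assms(2,3)] le[OF assms(3,2)] show ?thesis by linarith
qed

text \<open>The \<open>LEAST\<close> in \<open>covering_number\<close> is attained because a finite
  cover exists: for bounded \<open>E\<close>, finitely many cells of the grid of mesh
  \<open>\<rho>\<close> suffice.\<close>

lemma covering_number_cover:
  assumes "bounded E" "\<rho> > 0"
  obtains \<C> where "finite \<C>" "card \<C> = covering_number E \<rho>"
    "\<And>C. C \<in> \<C> \<Longrightarrow> interval_of_length \<rho> C" "E \<subseteq> \<Union>\<C>"
proof -
  define Q where "Q k \<longleftrightarrow> (\<exists>\<C>. finite \<C> \<and> card \<C> = k \<and>
        (\<forall>C\<in>\<C>. interval_of_length \<rho> C) \<and> E \<subseteq> \<Union>\<C>)" for k
  obtain B where B: "\<And>x. x \<in> E \<Longrightarrow> \<bar>x\<bar> \<le> B"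
    using assms(1) by (auto simp: bounded_iff)
  define \<C> where "\<C> = (\<lambda>i::int. {\<rho> * i .. \<rho> * i + \<rho>}) ` {\<lfloor>- B / \<rho>\<rfloor>..\<lfloor>B / \<rho>\<rfloor>}"
  have "Q (card \<C>)"
    unfolding Q_def
  proof (intro exI conjI ballI subsetI)
    show "finite \<C>" by (simp add: \<C>_def)
    show "interval_of_length \<rho> C" if "C \<in> \<C>" for C
    proof -
      from that obtain i :: int where "C = {\<rho> * i .. \<rho> * i + \<rho>}"
        by (auto simp: \<C>_def)
      then show ?thesis
        using interval_of_length_Icc[of "\<rho> * i" "\<rho> * i + \<rho>"] assms(2) by simp
    qed
    show "x \<in> \<Union>\<C>" if "x \<in> E" for x
    proof -
      let ?i = "\<lfloor>x / \<rho>\<rfloor>"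
      have "- B / \<rho> \<le> x / \<rho>" "x / \<rho> \<le> B / \<rho>"
        using B[OF that] assms(2) by (auto intro!: divide_right_mono simp del: divide_minus_left)
      then have "?i \<in> {\<lfloor>- B / \<rho>\<rfloor>..\<lfloor>B / \<rho>\<rfloor>}"
        using floor_mono by auto
      moreover have "of_int ?i * \<rho> \<le> x"
        using assms(2) by (simp flip: pos_le_divide_eq)
      moreover have "x \<le> (of_int ?i + 1) * \<rho>"
        using assms(2) by (simp flip: pos_divide_le_eq)
      ultimately have "?i \<in> {\<lfloor>- B / \<rho>\<rfloor>..\<lfloor>B / \<rho>\<rfloor>}" "x \<in> {\<rho> * ?i .. \<rho> * ?i + \<rho>}"
        by (simp_all add: algebra_simps)
      then show ?thesis unfolding \<C>_def by blast
    qed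
  qed simp
  then have "Q (covering_number E \<rho>)"
    unfolding covering_number_def Q_def[symmetric] by (rule LeastI)
  then show ?thesis using that unfolding Q_def by blast
qed

text \<open>Take the interval of an optimal cover that catches the most indices. Indices are counted
  rather than points, so coinciding values of \<open>f\<close> do no harm.\<close>

lemma covering_number_pigeonhole:
  fixes f :: "'a \<Rightarrow> real"
  assumes "finite G" "f ` G \<subseteq> E" "bounded E" "\<rho> > 0"
  shows "\<exists>G'\<subseteq>G. card G \<le> covering_number E \<rho> * card G' \<and>
    (\<forall>x\<in>G'. \<forall>y\<in>G'. \<bar>f x - f y\<bar> \<le> \<rho>)"
proof -
  obtain \<C> where \<C>: "finite \<C>" "card \<C> = covering_number E \<rho>"
    "\<And>C. C \<in> \<C> \<Longrightarrow> interval_of_length \<rho> C" "E \<subseteq> \<Union>\<C>"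
    using covering_number_cover[OF assms(3,4)] by blast
  define P where "P C = {x \<in> G. f x \<in> C}" for C
  show ?thesis
  proof (cases "G = {}")
    case False
    then have "\<C> \<noteq> {}" using \<C>(4) assms(2) by auto
    then obtain C where C: "C \<in> \<C>" "card (P C) = Max ((\<lambda>C. card (P C)) ` \<C>)"
      using Max_in[of "(\<lambda>C. card (P C)) ` \<C>"] \<C>(1) by (metis (no_types, lifting) finite_imageI image_iff image_is_empty)
    then have max: "card (P C') \<le> card (P C)" if "C' \<in> \<C>" for C'
      using \<C>(1) that by simp
    have "G \<subseteq> (\<Union>C\<in>\<C>. P C)" using \<C>(4) assms(2) by (auto simp: P_def)
    then have "card G \<le> card (\<Union>C\<in>\<C>. P C)"
      using assms(1) \<C>(1) by (intro card_mono) (auto simp: P_def)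
    also have "\<dots> \<le> (\<Sum>C\<in>\<C>. card (P C))" by (rule card_UN_le[OF \<C>(1)])
    also have "\<dots> \<le> card \<C> * card (P C)"
      using sum_bounded_above[of \<C> "\<lambda>C. card (P C)" "card (P C)"] max by simp
    finally have "card G \<le> covering_number E \<rho> * card (P C)"
      using \<C>(2) by simp
    moreover have "P C \<subseteq> G" by (auto simp: P_def)
    moreover have "\<bar>f x - f y\<bar> \<le> \<rho>" if "x \<in> P C" "y \<in> P C" for x y
      using interval_of_length_diff_le[OF \<C>(3)[OF C(1)]] that by (simp add: P_def)
    ultimately show ?thesis by (intro exI[of _ "P C"] conjI ballI)
  next
    case True
    then show ?thesis by (intro exI[of _ "{}"]) simp
  qed
qed

text \<open>Under the separation, the large class from the pigeonhole principle has at most one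
  index. The separation is strict because a closed interval of length \<open>\<rho>\<close> contains
  points at distance exactly \<open>\<rho>\<close>; hence the halved separations in the
  applications.\<close>

lemma card_le_covering_number:
  fixes f :: "'a \<Rightarrow> real"
  assumes "finite G" "f ` G \<subseteq> E" "bounded E" "\<rho> > 0"
    and "\<And>x y. x \<in> G \<Longrightarrow> y \<in> G \<Longrightarrow> x \<noteq> y \<Longrightarrow> \<rho> < \<bar>f x - f y\<bar>"
  shows "card G \<le> covering_number E \<rho>"
proof -
  obtain G' where G': "G' \<subseteq> G" "card G \<le> covering_number E \<rho> * card G'"
    "\<And>x y. x \<in> G' \<Longrightarrow> y \<in> G' \<Longrightarrow> \<bar>f x - f y\<bar> \<le> \<rho>"
    using covering_number_pigeonhole[OF assms(1-4)] by metis
  have "x = y" if "x \<in> G'" "y \<in> G'" for x y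
    using G'(1,3) assms(5) that by (meson not_le subsetD)
  then have "card G' \<le> Suc 0"
    using G'(1) assms(1) by (subst card_le_Suc0_iff_eq) (auto intro: finite_subset)
  then have "covering_number E \<rho> * card G' \<le> covering_number E \<rho> * 1"
    by (intro mult_left_mono) auto
  with G'(2) show ?thesis by linarith
qed

text \<open>Clearing logarithms turns a quotient below 1/4 into a bound on a fourth power. It is
  uniform in \<open>I\<close> because the supremum over \<open>I\<close> is taken before the limit
  in \<open>\<delta>\<close>.\<close>

lemma assouad_dim_lessD:
  assumes "assouad_dim E < 1 / 4"
  obtains d where "0 < d" "d < 1"
    "\<And>\<delta> l I. 0 < \<delta> \<Longrightarrow> \<delta> < d \<Longrightarrow> l > 0 \<Longrightarrow> interval_of_length l I \<Longrightarrow>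
       real (covering_number (E \<inter> I) (\<delta> * l)) ^ 4 \<le> 1 / \<delta>"
proof -
  have ereal_quarter: "1 / 4 = ereal (1 / 4)"
    unfolding one_ereal_def numeral_eq_ereal by (subst ereal_divide) simp_all
  have "eventually (\<lambda>\<delta>. (SUP I \<in> {I. \<exists>l>0. interval_of_length l I}.
         ereal (ln (real (covering_number (E \<inter> I) (\<delta> * measure lborel I))) / ln (1 / \<delta>))) < ereal (1 / 4))
       (at_right (0::real))"
    using assms unfolding assouad_dim_def ereal_quarter by (rule Limsup_lessD)
  then obtain b where b: "b > 0" "\<And>\<delta>. 0 < \<delta> \<Longrightarrow> \<delta> < b \<Longrightarrow>
      (SUP I \<in> {I. \<exists>l>0. interval_of_length l I}.
         ereal (ln (real (covering_number (E \<inter> I) (\<delta> * measure lborel I))) / ln (1 / \<delta>))) < ereal (1 / 4)"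
    by (auto simp: eventually_at_right_field)
  show ?thesis
  \<comment> \<open>The cap 1/2 forces \<open>\<delta> < 1\<close>, so that the denominator
    \<open>ln (1 / \<delta>)\<close> is positive.\<close>
  proof (rule that[of "min b (1/2)"])
    fix \<delta> l I
    assume *: "0 < \<delta>" "\<delta> < min b (1 / 2)" "l > 0" "interval_of_length l I"
    let ?N = "real (covering_number (E \<inter> I) (\<delta> * l))"
    have l: "measure lborel I = l" using *(4) by (simp add: interval_of_length_def)
    have "ereal (ln (real (covering_number (E \<inter> I) (\<delta> * measure lborel I))) / ln (1 / \<delta>)) < ereal (1 / 4)"
      by (rule SUP_lessD[OF b(2)]) (use * in auto)
    then have "ln ?N / ln (1 / \<delta>) < 1 / 4"
      unfolding l by simp
    moreover have "ln (1 / \<delta>) > 0" using * by (intro ln_gt_zero) auto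
    ultimately have "4 * ln ?N < ln (1 / \<delta>)" by (simp add: field_simps)
    show "?N ^ 4 \<le> 1 / \<delta>"
    proof (cases "?N = 0")
      case False
      then have "ln (?N ^ 4) < ln (1 / \<delta>)"
        using \<open>4 * ln ?N < ln (1 / \<delta>)\<close> by (simp add: ln_realpow)
      then show ?thesis using * False by (subst (asm) ln_less_cancel_iff) auto
    qed (use * in auto)
  qed (use b in auto)
qed

subsection \<open>Density and orbits\<close>

text \<open>If all windows of some length \<open>L\<close> met the complement of \<open>J\<close> in
  too few points, tiling an initial segment by them would make \<open>J\<close> too dense there. The
  constant \<open>c\<close> serves all \<open>L\<close> at once.\<close>

lemma windows_of_lower_density_less_1:
  assumes "lower_density J < 1"
  obtains c where "0 < c"
    "\<And>L. L \<ge> 1 \<Longrightarrow> \<exists>a. c * real L \<le> real (card ({a<..a + L} - J))"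
proof -
  obtain r where r: "lower_density J < ereal r" "ereal r < 1"
    using assms ereal_dense2 by blast
  have r1: "r < 1" using r(2) by (simp add: one_ereal_def)
  have "\<exists>a. (1 - r) / 2 * real L \<le> real (card ({a<..a + L} - J))" if L: "L \<ge> 1" for L :: nat
  proof (rule ccontr)
    assume "\<not> ?thesis"
    then have small: "real (card ({a<..a + L} - J)) < (1 - r) / 2 * real L" for a
      by (simp add: not_le)
    \<comment> \<open>A liminf below \<open>r\<close> yields arbitrarily large \<open>N\<close> with
      ratio below \<open>r\<close>. For \<open>N \<ge> L\<close>, rounding up to whole windows at
      most doubles the length; this is the factor 1/2 in the constant.\<close>
    have "\<not> eventually (\<lambda>N. ereal r \<le> ereal (real (card (J \<inter> {1..N})) / real N)) sequentially"
      using r(1) Liminf_bounded unfolding lower_density_def by (metis leD)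
    then obtain N where N: "N \<ge> L" "real (card (J \<inter> {1..N})) / real N < r"
      by (auto simp: eventually_sequentially not_le)
    have "real (card ({0<..n * L} - J)) \<le> n * ((1 - r) / 2 * real L)" for n
    proof (induction n)
      case (Suc n)
      have "{0<..Suc n * L} - J \<subseteq> ({0<..n * L} - J) \<union> ({n * L<..n * L + L} - J)"
        by auto
      then have "card ({0<..Suc n * L} - J)
          \<le> card (({0<..n * L} - J) \<union> ({n * L<..n * L + L} - J))"
        by (intro card_mono) auto
      also have "\<dots> \<le> card ({0<..n * L} - J) + card ({n * L<..n * L + L} - J)"
        by (rule card_Un_le)
      finally show ?case using Suc.IH small[of "n * L"] by (simp add: field_simps)
    qed simp
    from this[of "N div L + 1"]
    have "real (card ({0<..(N div L + 1) * L} - J)) \<le> (1 - r) / 2 * real ((N div L + 1) * L)"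
      by (simp add: field_simps)
    also have "\<dots> \<le> (1 - r) / 2 * real (N + L)"
      using r1 by (intro mult_left_mono) (auto simp del: of_nat_add of_nat_mult)
    also have "\<dots> \<le> (1 - r) / 2 * real (N + N)"
      using r1 N(1) by (intro mult_left_mono) auto
    finally have 1: "real (card ({0<..(N div L + 1) * L} - J)) \<le> (1 - r) * real N"
      by (simp add: field_simps)
    have "N < (N div L + 1) * L"
      using L dividend_less_div_times[of L N] by simp
    then have "{1..N} - J \<subseteq> {0<..(N div L + 1) * L} - J" by auto
    then have "card ({1..N} - J) \<le> card ({0<..(N div L + 1) * L} - J)"
      by (intro card_mono) auto
    moreover have "card ({1..N} - J) + card (J \<inter> {1..N}) = N"
      using card_Diff_subset_Int[of "{1..N}" J] card_mono[of "{1..N}" "J \<inter> {1..N}"]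
      by (simp add: Int_commute)
    ultimately have "real N - real (card (J \<inter> {1..N})) \<le> (1 - r) * real N"
      using 1 by linarith
    moreover have "real (card (J \<inter> {1..N})) < r * real N"
      using N L by (simp add: field_simps)
    ultimately show False by (simp add: algebra_simps)
  qed
  with r1 show ?thesis by (intro that[of "(1 - r) / 2"]; simp)
qed

lemma rat_independent_with_1_imp:
  assumes "rat_independent_with_1 \<alpha> \<beta>" "of_int a * \<alpha> + of_int b * \<beta> = of_int c"
  shows "a = 0 \<and> b = 0"
proof -
  interpret module "\<lambda>(q :: rat) (x :: real). of_rat q * x"
    by unfold_locales (auto simp: algebra_simps of_rat_add of_rat_mult)
  have d: "1 \<noteq> \<alpha>" "1 \<noteq> \<beta>" "\<alpha> \<noteq> \<beta>" and ind: "independent {1, \<alpha>, \<beta>}"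
    using assms(1) by (auto simp: rat_independent_with_1_def)
  \<comment> \<open>Independence of a set concerns coefficient functions on it; distinctness of 1,
    \<alpha>, \<beta> lets \<open>u\<close> take three prescribed values.\<close>
  define u where "u v = (if v = 1 then - of_int c else if v = \<alpha> then of_int a else of_int b :: rat)"
    for v
  have "(\<Sum>v\<in>{1, \<alpha>, \<beta>}. of_rat (u v) * v) = 0"
    using d assms(2) by (simp add: u_def of_rat_minus)
  then have "u v = 0" if "v \<in> {1, \<alpha>, \<beta>}" for v
    using independentD[OF ind, of "{1, \<alpha>, \<beta>}" u v] that by blast
  from this[of \<alpha>] this[of \<beta>] show ?thesis using d by (auto simp: u_def)
qed

subsection \<open>Best approximations\<close>

text \<open>The third column will hold values of \<open>L\<close>, which up to sign differ from the integers
  \<open>m\<close> by a combination of the other two columns, so the determinant is still an integer.\<close>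

definition det3 :: "real \<Rightarrow> real \<Rightarrow> real \<Rightarrow> real \<Rightarrow> real \<Rightarrow> real \<Rightarrow> real \<Rightarrow> real \<Rightarrow> real \<Rightarrow> real" where
  "det3 a b x a' b' x' a'' b'' x'' =
     x * (a' * b'' - a'' * b') - x' * (a * b'' - a'' * b) + x'' * (a * b' - a' * b)"

text \<open>Both products lie between 0 and \<open>a * a'\<close>, so their difference is bounded
  without a factor 2.\<close>

lemma minor_abs_le:
  fixes a b a' b' :: real
  assumes "0 \<le> b" "b \<le> a" "0 \<le> b'" "b' \<le> a'"
  shows "\<bar>a * b' - a' * b\<bar> \<le> a * a'"
proof -
  have "a * b' \<le> a * a'" "a' * b \<le> a' * a" "0 \<le> a * b'" "0 \<le> a' * b"
    using assms by (auto intro!: mult_left_mono)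
  then show ?thesis by (simp add: abs_le_iff mult.commute)
qed

lemma det3_abs_le:
  fixes a b a' b' a'' b'' :: real
  assumes "0 \<le> b" "b \<le> a" "0 \<le> b'" "b' \<le> a'" "0 \<le> b''" "b'' \<le> a''"
  shows "\<bar>det3 a b x a' b' x' a'' b'' x''\<bar>
    \<le> \<bar>x\<bar> * (a' * a'') + \<bar>x'\<bar> * (a * a'') + \<bar>x''\<bar> * (a * a')"
proof -
  have "\<bar>x * (a' * b'' - a'' * b')\<bar> \<le> \<bar>x\<bar> * (a' * a'')"
    "\<bar>x' * (a * b'' - a'' * b)\<bar> \<le> \<bar>x'\<bar> * (a * a'')"
    "\<bar>x'' * (a * b' - a' * b)\<bar> \<le> \<bar>x''\<bar> * (a * a')"
    using assms minor_abs_le by (auto simp: abs_mult intro!: mult_left_mono)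
  then show ?thesis unfolding det3_def by linarith
qed

section \<open>Consequences of dimension below 1/4\<close>

text \<open>Collects what the negated theorem supplies, with \<open>A\<close> the times outside
  \<open>J\<close>: \<open>window\<close> comes from the density, \<open>covering_small\<close> from
  the dimension. The assumptions are jointly contradictory, as \<open>inconsistent\<close>
  shows.\<close>

locale low_dimensional_orbit =
  fixes \<alpha> \<gamma> :: real and t :: "nat \<Rightarrow> real" and A :: "nat set" and c d :: real
    and L :: "nat \<Rightarrow> nat \<Rightarrow> int \<Rightarrow> real"
  defines "L \<equiv> \<lambda>k j m. real k * \<alpha> + real j * \<gamma> - real_of_int m"
  assumes t_range: "n \<in> A \<Longrightarrow> t n \<in> {0..<1}"
    and t_diff: "n \<in> A \<Longrightarrow> n' \<in> A \<Longrightarrow> n < n' \<Longrightarrow> \<exists>j\<le>n' - n. \<exists>m. t n' - t n = L (n' - n) j m"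
    and L_nonzero: "1 \<le> k \<Longrightarrow> j \<le> k \<Longrightarrow> L k j m \<noteq> 0"
    and c_pos: "0 < c"
    and window: "1 \<le> T \<Longrightarrow> \<exists>a. c * real T \<le> real (card ({a<..a + T} \<inter> A))"
    and d: "0 < d" "d < 1"
    and covering_small: "0 < \<delta> \<Longrightarrow> \<delta> < d \<Longrightarrow> l > 0 \<Longrightarrow> interval_of_length l I \<Longrightarrow>
       real (covering_number (t ` A \<inter> I) (\<delta> * l)) ^ 4 \<le> 1 / \<delta>"
begin

lemma bounded_orbit: "bounded (t ` A)"
  by (rule bounded_subset[of "{0..1}"]) (use t_range in fastforce)+

lemma covering_orbit:
  assumes "0 < \<delta>" "\<delta> < d"
  shows "real (covering_number (t ` A) \<delta>) ^ 4 \<le> 1 / \<delta>"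
proof -
  have "t ` A \<inter> {0..1} = t ` A" using t_range by fastforce
  then show ?thesis
    using covering_small[OF assms, of 1 "{0..1}"] interval_of_length_Icc[of 0 1] by simp
qed

lemma abs_t_diff:
  assumes "n \<in> A" "n' \<in> A" "n \<noteq> n'" "n < n' + T" "n' < n + T"
  shows "\<exists>k j m. 1 \<le> k \<and> k < T \<and> j \<le> k \<and> \<bar>t n - t n'\<bar> = \<bar>L k j m\<bar>"
proof (cases "n < n'")
  case True
  with t_diff[OF assms(1,2)] obtain j m where "j \<le> n' - n" "t n' - t n = L (n' - n) j m"
    by blast
  moreover have "1 \<le> n' - n" "n' - n < T" using True assms(5) by auto
  ultimately show ?thesis by (metis abs_minus_commute)
next
  case False
  with t_diff[OF assms(2,1)] assms(3) obtain j m where "j \<le> n - n'" "t n - t n' = L (n - n') j m"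
    by fastforce
  moreover have "1 \<le> n - n'" "n - n' < T" using False assms(3,4) by auto
  ultimately show ?thesis by metis
qed

text \<open>Times in one window of length \<open>T\<close> differ by less than \<open>T\<close>, so
  the hypothesis separates the corresponding orbit points by \<open>\<delta>\<close>; a rich window
  has at least \<open>c * T\<close> of them.\<close>

lemma separated_window:
  assumes "0 < \<delta>" "1 \<le> T"
    and "\<And>k j m. 1 \<le> k \<Longrightarrow> k < T \<Longrightarrow> j \<le> k \<Longrightarrow> \<delta> \<le> \<bar>L k j m\<bar>"
  shows "c * real T \<le> real (covering_number (t ` A) (\<delta> / 2))"
proof -
  obtain a where a: "c * real T \<le> real (card ({a<..a + T} \<inter> A))"
    using window[OF assms(2)] by blast
  have "card ({a<..a + T} \<inter> A) \<le> covering_number (t ` A) (\<delta> / 2)"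
  proof (rule card_le_covering_number[where f = t])
    show "\<delta> / 2 < \<bar>t x - t y\<bar>"
      if "x \<in> {a<..a + T} \<inter> A" "y \<in> {a<..a + T} \<inter> A" "x \<noteq> y" for x y
    proof -
      have "\<exists>k j m. 1 \<le> k \<and> k < T \<and> j \<le> k \<and> \<bar>t x - t y\<bar> = \<bar>L k j m\<bar>"
        by (rule abs_t_diff) (use that in auto)
      then have "\<delta> \<le> \<bar>t x - t y\<bar>" using assms(3) by metis
      then show ?thesis using assms(1) by linarith
    qed
  qed (use bounded_orbit assms in auto)
  then show ?thesis using a by linarith
qed

text \<open>Otherwise a covering number at one fixed scale would be at least \<open>c * T\<close>
  for every \<open>T\<close>.\<close>

lemma ex_small:
  assumes "0 < \<delta>"
  shows "\<exists>k\<ge>1. \<exists>j\<le>k. \<exists>m. \<bar>L k j m\<bar> < \<delta>"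
proof (rule ccontr)
  assume "\<not> ?thesis"
  then have *: "c * real T \<le> real (covering_number (t ` A) (\<delta> / 2))" if "1 \<le> T" for T
    using separated_window[OF assms that] by (meson not_le)
  obtain T where "real (covering_number (t ` A) (\<delta> / 2)) < real T * c"
    using reals_Archimedean3[OF c_pos] by blast
  then show False using *[of T] c_pos
    by (cases "T = 0") (auto simp: mult.commute)
qed

text \<open>For each of the finitely many \<open>j\<close> the best \<open>m\<close> is given by
  rounding, so the minimum over infinitely many pairs exists.\<close>

lemma ex_best:
  assumes "1 \<le> q"
  shows "\<exists>j\<le>q. \<exists>m. \<forall>j'\<le>q. \<forall>m'. \<bar>L q j m\<bar> \<le> \<bar>L q j' m'\<bar>"
proof -
  define f where "f j = \<bar>L q j (round (real q * \<alpha> + real j * \<gamma>))\<bar>" for j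
  obtain j where j: "j \<le> q" "\<And>j'. j' \<le> q \<Longrightarrow> f j \<le> f j'"
    using arg_min_if_finite[of "{..q}" f] by (metis atMost_iff empty_iff finite_atMost le0 not_le)
  moreover have "f j' \<le> \<bar>L q j' m'\<bar>" for j' m'
    unfolding f_def L_def by (rule round_diff_minimal)
  ultimately have "f j \<le> \<bar>L q j' m'\<bar>" if "j' \<le> q" for j' m'
    using that by (meson order_trans)
  then have "\<forall>j'\<le>q. \<forall>m'. \<bar>L q j (round (real q * \<alpha> + real j * \<gamma>))\<bar> \<le> \<bar>L q j' m'\<bar>"
    unfolding f_def by simp
  with j(1) show ?thesis by (intro exI conjI)
qed

text \<open>Take the least \<open>q'\<close> that admits a value below \<open>\<delta>\<close>, then
  the smallest value at this \<open>q'\<close>.\<close>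

lemma ex_next_best:
  assumes "1 \<le> q" "\<And>k j' m'. 1 \<le> k \<Longrightarrow> k \<le> q \<Longrightarrow> j' \<le> k \<Longrightarrow> \<delta> \<le> \<bar>L k j' m'\<bar>" "0 < \<delta>"
  shows "\<exists>q' j m. q < q' \<and> j \<le> q' \<and> \<bar>L q' j m\<bar> < \<delta> \<and>
    (\<forall>k j' m'. 1 \<le> k \<longrightarrow> k < q' \<longrightarrow> j' \<le> k \<longrightarrow> \<delta> \<le> \<bar>L k j' m'\<bar>) \<and>
    (\<forall>j'\<le>q'. \<forall>m'. \<bar>L q' j m\<bar> \<le> \<bar>L q' j' m'\<bar>)"
proof -
  define P where "P k \<longleftrightarrow> 1 \<le> k \<and> (\<exists>j\<le>k. \<exists>m. \<bar>L k j m\<bar> < \<delta>)" for k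
  define q' where "q' = (LEAST k. P k)"
  have "\<exists>k. P k" using ex_small[OF assms(3)] unfolding P_def by blast
  then have P: "P q'" unfolding q'_def by (rule LeastI_ex)
  have less: "\<not> P k" if "k < q'" for k using that not_less_Least unfolding q'_def by blast
  have "q < q'"
  proof (rule ccontr)
    assume "\<not> q < q'"
    then have "\<delta> \<le> \<bar>L q' j' m'\<bar>" if "j' \<le> q'" for j' m'
      using assms(2) P that unfolding P_def by simp
    then show False using P unfolding P_def by (meson not_le)
  qed
  obtain j m where jm: "j \<le> q'" "\<And>j' m'. j' \<le> q' \<Longrightarrow> \<bar>L q' j m\<bar> \<le> \<bar>L q' j' m'\<bar>"
    using ex_best[of q'] P by (auto simp: P_def)
  have "\<bar>L q' j m\<bar> < \<delta>" using P jm(2) unfolding P_def by (meson le_less_trans)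
  moreover have "\<delta> \<le> \<bar>L k j' m'\<bar>" if "1 \<le> k" "k < q'" "j' \<le> k" for k j' m'
    using less[of k] that unfolding P_def by (meson not_le)
  ultimately show ?thesis using \<open>q < q'\<close> jm by metis
qed

lemma ex_best_approximations:
  obtains q j :: "nat \<Rightarrow> nat" and m :: "nat \<Rightarrow> int"
  where "\<And>i. 1 \<le> q i" "\<And>i. j i \<le> q i" "\<And>i. q i < q (Suc i)"
    "\<And>i. \<bar>L (q (Suc i)) (j (Suc i)) (m (Suc i))\<bar> < \<bar>L (q i) (j i) (m i)\<bar>"
    "\<And>i k j' m'. 1 \<le> k \<Longrightarrow> k < q (Suc i) \<Longrightarrow> j' \<le> k \<Longrightarrow> \<bar>L (q i) (j i) (m i)\<bar> \<le> \<bar>L k j' m'\<bar>"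
proof -
  \<comment> \<open>\<open>P\<close> is the invariant of the recursion and \<open>Q\<close> links
    consecutive records. Minimality in \<open>P\<close> includes \<open>k = q\<close>, which makes
    the next index strictly larger.\<close>
  define P where "P x = (case x of (q, j, m) \<Rightarrow> 1 \<le> q \<and> j \<le> q \<and>
    (\<forall>k j' m'. 1 \<le> k \<longrightarrow> k \<le> q \<longrightarrow> j' \<le> k \<longrightarrow> \<bar>L q j m\<bar> \<le> \<bar>L k j' m'\<bar>))"
    for x :: "nat \<times> nat \<times> int"
  define Q where "Q x y = (case x of (q, j, m) \<Rightarrow> case y of (q', j', m') \<Rightarrow>
    q < q' \<and> \<bar>L q' j' m'\<bar> < \<bar>L q j m\<bar> \<and>
    (\<forall>k i n. 1 \<le> k \<longrightarrow> k < q' \<longrightarrow> i \<le> k \<longrightarrow> \<bar>L q j m\<bar> \<le> \<bar>L k i n\<bar>))"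
    for x y :: "nat \<times> nat \<times> int"
  have "\<exists>f. \<forall>n. P (f n) \<and> Q (f n) (f (Suc n))"
  proof (rule dependent_nat_choice)
    obtain j m where jm: "j \<le> 1" "\<And>j' m'. j' \<le> 1 \<Longrightarrow> \<bar>L 1 j m\<bar> \<le> \<bar>L 1 j' m'\<bar>"
      using ex_best[of 1] by auto
    have "P (1, j, m)" unfolding P_def using jm by (auto simp: le_antisym)
    then show "\<exists>x. P x" by blast
  next
    fix x :: "nat \<times> nat \<times> int" and n :: nat
    assume Px: "P x"
    obtain q j m where x: "x = (q, j, m)" by (cases x)
    have q: "1 \<le> q" "j \<le> q"
      and min: "\<And>k j' m'. 1 \<le> k \<Longrightarrow> k \<le> q \<Longrightarrow> j' \<le> k \<Longrightarrow> \<bar>L q j m\<bar> \<le> \<bar>L k j' m'\<bar>"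
      using Px by (auto simp: P_def x)
    have pos: "0 < \<bar>L q j m\<bar>" using L_nonzero[OF q] by simp
    have "\<exists>q' j' m'. q < q' \<and> j' \<le> q' \<and> \<bar>L q' j' m'\<bar> < \<bar>L q j m\<bar> \<and>
      (\<forall>k i n. 1 \<le> k \<longrightarrow> k < q' \<longrightarrow> i \<le> k \<longrightarrow> \<bar>L q j m\<bar> \<le> \<bar>L k i n\<bar>) \<and>
      (\<forall>i\<le>q'. \<forall>n. \<bar>L q' j' m'\<bar> \<le> \<bar>L q' i n\<bar>)"
      by (rule ex_next_best) (use q min pos in auto)
    then obtain q' j' m' where y: "q < q'" "j' \<le> q'"
      "\<bar>L q' j' m'\<bar> < \<bar>L q j m\<bar>"
      "\<And>k i n. 1 \<le> k \<Longrightarrow> k < q' \<Longrightarrow> i \<le> k \<Longrightarrow> \<bar>L q j m\<bar> \<le> \<bar>L k i n\<bar>"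
      "\<And>i n. i \<le> q' \<Longrightarrow> \<bar>L q' j' m'\<bar> \<le> \<bar>L q' i n\<bar>"
      by blast
    have "\<bar>L q' j' m'\<bar> \<le> \<bar>L k i n\<bar>" if "1 \<le> k" "k \<le> q'" "i \<le> k" for k i n
    proof (cases "k = q'")
      case False
      then show ?thesis using y(3) y(4)[of k i n] that by linarith
    qed (use y(5) that in auto)
    then have "P (q', j', m')" using y q by (auto simp: P_def)
    moreover have "Q x (q', j', m')" using y by (auto simp: Q_def x)
    ultimately show "\<exists>y. P y \<and> Q x y" by blast
  qed
  then obtain f where f: "\<And>n. P (f n)" "\<And>n. Q (f n) (f (Suc n))" by blast
  have f_eq: "f n = (fst (f n), fst (snd (f n)), snd (snd (f n)))" for n by simp
  show ?thesis
  proof (rule that[of "\<lambda>n. fst (f n)" "\<lambda>n. fst (snd (f n))" "\<lambda>n. snd (snd (f n))"])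
    fix i k j' m'
    show "1 \<le> fst (f i)" "fst (snd (f i)) \<le> fst (f i)"
      using f(1)[of i] by (auto simp: P_def case_prod_beta)
    show "fst (f i) < fst (f (Suc i))"
      "\<bar>L (fst (f (Suc i))) (fst (snd (f (Suc i)))) (snd (snd (f (Suc i))))\<bar>
        < \<bar>L (fst (f i)) (fst (snd (f i))) (snd (snd (f i)))\<bar>"
      using f(2)[of i] by (auto simp: Q_def case_prod_beta)
    show "\<bar>L (fst (f i)) (fst (snd (f i))) (snd (snd (f i)))\<bar> \<le> \<bar>L k j' m'\<bar>"
      if "1 \<le> k" "k < fst (f (Suc i))" "j' \<le> k"
      using f(2)[of i] that by (auto simp: Q_def case_prod_beta)
  qed
qed

section \<open>Integrality of minors and linear dependence\<close>

lemma det3_L_Ints: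
  "det3 k j (L k j m) k' j' (L k' j' m') k'' j'' (L k'' j'' m'') \<in> \<int>"
proof -
  have "det3 k j (L k j m) k' j' (L k' j' m') k'' j'' (L k'' j'' m'')
    = - det3 k j m k' j' m' k'' j'' m''"
    by (simp add: det3_def L_def algebra_simps)
  also have "\<dots> \<in> \<int>"
    unfolding det3_def by (intro Ints_minus Ints_add Ints_diff Ints_mult) auto
  finally show ?thesis .
qed

text \<open>The \<alpha> terms always cancel and the \<gamma> terms cancel by assumption, which
  leaves the integer parts.\<close>

lemma minor_L_Ints:
  assumes "real k * j' = real k' * j"
  shows "k * L k' j' m' - k' * L k j m \<in> \<int>"
proof -
  have "k * L k' j' m' - k' * L k j m = (real k * j' - real k' * j) * \<gamma> - (k * m' - k' * m)"
    by (simp add: L_def algebra_simps)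
  also have "\<dots> \<in> \<int>" using assms by simp
  finally show ?thesis .
qed

text \<open>The fourth power of the lower bound \<open>c * T\<close> for a covering number is
  compared with its upper bound \<open>2 / \<delta>\<close>. The maximum with 1 only normalises
  \<open>K\<close>.\<close>

lemma separation_bound:
  obtains K T0 where "1 \<le> K"
    "\<And>T \<delta>. T0 \<le> T \<Longrightarrow> 0 < \<delta> \<Longrightarrow>
      (\<And>k j m. 1 \<le> k \<Longrightarrow> k < T \<Longrightarrow> j \<le> k \<Longrightarrow> \<delta> \<le> \<bar>L k j m\<bar>) \<Longrightarrow> real T ^ 4 * \<delta> \<le> K"
proof -
  obtain T0 :: nat where T0: "2 < real T0 * (c ^ 4 * d)"
    using reals_Archimedean3[of "c ^ 4 * d"] c_pos d(1) by auto
  show ?thesis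
  proof (rule that[of "max 1 (2 / c ^ 4)" T0])
    fix T \<delta>
    assume T: "T0 \<le> T" and \<delta>: "0 < \<delta>"
      and sep: "\<And>k j m. 1 \<le> k \<Longrightarrow> k < T \<Longrightarrow> j \<le> k \<Longrightarrow> \<delta> \<le> \<bar>L k j m\<bar>"
    have T1: "1 \<le> T" using T T0 by (cases "T = 0") auto
    \<comment> \<open>The covering bound holds only at scales below \<open>d\<close>, so
      \<open>\<delta>\<close> is truncated. The choice of \<open>T0\<close> rules out afterwards
      that the truncation took effect.\<close>
    let ?e = "min \<delta> d"
    have e: "0 < ?e" using \<delta> d(1) by simp
    have "?e \<le> \<bar>L k j m\<bar>" if "1 \<le> k" "k < T" "j \<le> k" for k j m
      using sep[OF that] by (rule min.coboundedI1)
    then have "c * real T \<le> real (covering_number (t ` A) (?e / 2))"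
      by (rule separated_window[OF e T1])
    then have "(c * real T) ^ 4 \<le> real (covering_number (t ` A) (?e / 2)) ^ 4"
      using c_pos by (intro power_mono) auto
    also have "\<dots> \<le> 1 / (?e / 2)"
      using e d(1) by (intro covering_orbit) auto
    finally have *: "c ^ 4 * real T ^ 4 * ?e \<le> 2"
      using e by (simp add: power_mult_distrib pos_le_divide_eq)
    have "real T0 * (c ^ 4 * d) \<le> real T ^ 4 * (c ^ 4 * d)"
    proof (rule mult_right_mono)
      have "real T0 \<le> real T" using T by simp
      also have "\<dots> \<le> real T ^ 4" using T1 by (intro self_le_power) auto
      finally show "real T0 \<le> real T ^ 4" .
    qed (use c_pos d(1) in auto)
    then have "2 < c ^ 4 * real T ^ 4 * d" using T0 by (simp add: mult_ac)
    then have "?e = \<delta>" using * by (metis min_def not_le)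
    then have "real T ^ 4 * \<delta> \<le> 2 / c ^ 4"
      using * c_pos by (simp add: pos_le_divide_eq mult_ac)
    then show "real T ^ 4 * \<delta> \<le> max 1 (2 / c ^ 4)" by simp
  qed simp
qed

text \<open>If all triples were dependent from some point on, the ratio of the minors \<open>a i\<close> and \<open>D i\<close>
  would be a nonzero constant, although \<open>a i\<close> tends to 0 and \<open>D i\<close> is a nonzero integer.\<close>

lemma infinitely_many_independent_triples:
  fixes q j :: "nat \<Rightarrow> nat" and m :: "nat \<Rightarrow> int"
  defines "x \<equiv> \<lambda>i. L (q i) (j i) (m i)"
  assumes q: "\<And>i. 1 \<le> q i" and jq: "\<And>i. j i \<le> q i" and qS: "\<And>i. q i < q (Suc i)"
    and dec: "\<And>i. \<bar>x (Suc i)\<bar> < \<bar>x i\<bar>"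
    and bound: "\<And>i. i0 \<le> i \<Longrightarrow> real (q (Suc i)) ^ 4 * \<bar>x i\<bar> \<le> K"
  shows "\<exists>i\<ge>i1. det3 (q i) (j i) (x i) (q (Suc i)) (j (Suc i)) (x (Suc i))
    (q (Suc (Suc i))) (j (Suc (Suc i))) (x (Suc (Suc i))) \<noteq> 0"
proof (rule ccontr)
  assume "\<not> ?thesis"
  then have det: "det3 (q i) (j i) (x i) (q (Suc i)) (j (Suc i)) (x (Suc i))
    (q (Suc (Suc i))) (j (Suc (Suc i))) (x (Suc (Suc i))) = 0" if "i1 \<le> i" for i
    using that by blast
  \<comment> \<open>\<open>a i\<close> and \<open>D i\<close> are minors of the consecutive rows
    \<open>i\<close> and \<open>Suc i\<close>, in the columns of \<open>q\<close>, \<open>x\<close>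
    and of \<open>q\<close>, \<open>j\<close>.\<close>
  define a where "a i = q i * x (Suc i) - q (Suc i) * x i" for i
  define D where "D i = real (q i) * j (Suc i) - real (q (Suc i)) * j i" for i
  have q_ge: "Suc i \<le> q i" for i
    by (induction i) (use q qS in \<open>auto simp: Suc_le_eq intro: le_less_trans\<close>)
  have a_nz: "a i \<noteq> 0" for i
  proof -
    have "\<bar>q i * x (Suc i)\<bar> = real (q i) * \<bar>x (Suc i)\<bar>" by (simp add: abs_mult)
    also have "\<dots> < real (q (Suc i)) * \<bar>x i\<bar>"
      using qS[of i] dec[of i] by (intro mult_strict_mono) auto
    also have "\<dots> = \<bar>q (Suc i) * x i\<bar>" by (simp add: abs_mult)
    finally show ?thesis by (auto simp: a_def)
  qed
  have a_le: "\<bar>a i\<bar> * real (q (Suc i)) \<le> 2 * K" if "i0 \<le> i" for i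
  proof -
    let ?Q = "real (q (Suc i))"
    have "real (q i) * \<bar>x (Suc i)\<bar> \<le> ?Q * \<bar>x i\<bar>"
      using qS[of i] dec[of i] by (intro mult_mono) auto
    then have "\<bar>a i\<bar> \<le> 2 * (?Q * \<bar>x i\<bar>)"
      unfolding a_def using abs_triangle_ineq4[of "q i * x (Suc i)" "q (Suc i) * x i"]
      by (simp add: abs_mult)
    then have "\<bar>a i\<bar> * ?Q \<le> 2 * (?Q * \<bar>x i\<bar>) * ?Q"
      by (rule mult_right_mono) simp
    also have "\<dots> = 2 * (?Q ^ 2 * \<bar>x i\<bar>)" by (simp add: power2_eq_square)
    also have "\<dots> \<le> 2 * (?Q ^ 4 * \<bar>x i\<bar>)"
      using q[of "Suc i"] by (intro mult_left_mono mult_right_mono power_increasing) auto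
    also have "\<dots> \<le> 2 * K" using bound[OF that] by simp
    finally show ?thesis .
  qed
  obtain i2 :: nat where i2: "2 * K < real i2" using reals_Archimedean2 by blast
  define b where "b = max i0 (max i1 i2)"
  have b: "i0 \<le> i" "i1 \<le> i" "2 * K < real (q (Suc i))" if "b \<le> i" for i
    using that i2 q_ge[of "Suc i"] by (auto simp: b_def)
  \<comment> \<open>If \<open>D i\<close> vanished, \<open>a i\<close> would be a nonzero integer of
    absolute value less than 1.\<close>
  have D_nz: "D i \<noteq> 0" if "b \<le> i" for i
  proof
    assume "D i = 0"
    then have "a i \<in> \<int>"
      unfolding a_def x_def by (intro minor_L_Ints) (simp add: D_def)
    moreover have "\<bar>a i\<bar> < 1"
    proof (rule ccontr)
      assume "\<not> \<bar>a i\<bar> < 1"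
      then have "1 * real (q (Suc i)) \<le> \<bar>a i\<bar> * real (q (Suc i))"
        by (intro mult_right_mono) auto
      then show False using a_le[of i] b[OF that] by linarith
    qed
    ultimately show False using a_nz Ints_nonzero_abs_less1 by blast
  qed
  have D_ge: "1 \<le> \<bar>D i\<bar>" if "b \<le> i" for i
  proof -
    have "D i \<in> \<int>" unfolding D_def by (intro Ints_diff Ints_mult) auto
    then show ?thesis using D_nz[OF that] Ints_nonzero_abs_ge1 by blast
  qed
  \<comment> \<open>This is the Desnanot-Jacobi identity for the three rows, with central entry
    \<open>q (Suc i)\<close>; the vanishing determinant makes consecutive ratios of \<open>a\<close>
    and \<open>D\<close> equal.\<close>
  have ratio_step: "a i * D (Suc i) = a (Suc i) * D i" if "b \<le> i" for i
  proof -
    have "a i * D (Suc i) - a (Suc i) * D i = - (q (Suc i) *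
      det3 (q i) (j i) (x i) (q (Suc i)) (j (Suc i)) (x (Suc i))
        (q (Suc (Suc i))) (j (Suc (Suc i))) (x (Suc (Suc i))))"
      unfolding a_def D_def det3_def by algebra
    then show ?thesis using det b[OF that] by simp
  qed
  have ratio: "a b * D n = a n * D b" if "b \<le> n" for n
    using that
  proof (induction n rule: dec_induct)
    case (step n)
    have "D n * (a b * D (Suc n)) = (a b * D n) * D (Suc n)" by simp
    also have "\<dots> = (a n * D (Suc n)) * D b" by (simp add: step.IH)
    also have "\<dots> = D n * (a (Suc n) * D b)" by (simp add: ratio_step[OF step.hyps(1)])
    finally show ?case using D_nz[OF step.hyps(1)] by simp
  qed simp
  \<comment> \<open>Since \<open>\<bar>D n\<bar> \<ge> 1\<close>, the constant ratio and
    \<open>a_le\<close> bound \<open>q (Suc n) * \<bar>a b\<bar>\<close> by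
    \<open>2 * K * \<bar>D b\<bar>\<close> for all large \<open>n\<close>; \<open>n0\<close> is
    chosen to violate this.\<close>
  obtain n0 where n0: "2 * K * \<bar>D b\<bar> < real n0 * \<bar>a b\<bar>"
    using reals_Archimedean3[of "\<bar>a b\<bar>"] a_nz[of b] by auto
  define n where "n = max n0 b"
  have n: "b \<le> n" by (simp add: n_def)
  let ?Q = "real (q (Suc n))"
  have "real n0 * \<bar>a b\<bar> \<le> ?Q * (\<bar>a b\<bar> * \<bar>D n\<bar>)"
  proof (rule mult_mono)
    show "real n0 \<le> ?Q" using q_ge[of "Suc n"] by (simp add: n_def)
    show "\<bar>a b\<bar> \<le> \<bar>a b\<bar> * \<bar>D n\<bar>"
      using mult_left_mono[OF D_ge[OF n], of "\<bar>a b\<bar>"] by simp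
  qed auto
  also have "\<dots> = (\<bar>a n\<bar> * ?Q) * \<bar>D b\<bar>"
    using ratio[OF n] by (simp flip: abs_mult)
  also have "\<dots> \<le> 2 * K * \<bar>D b\<bar>"
    using a_le b n by (intro mult_right_mono) auto
  finally show False using n0 by simp
qed

text \<open>Integers of absolute value below 1 vanish, three times: first the full determinant, then
  the minor \<open>?D\<close> of integer entries, finally the minor containing \<open>y\<close> and
  \<open>x1\<close>. The bound on \<open>y\<close> makes its contribution at most a quarter of
  \<open>\<bar>x0\<bar>\<close>.\<close>

lemma collinear_if_small:
  fixes q0 j0 q1 j1 k j T :: nat and m0 m1 m :: int
  defines "x0 \<equiv> L q0 j0 m0" and "x1 \<equiv> L q1 j1 m1" and "y \<equiv> L k j m"
  assumes q: "1 \<le> q0" "q0 < q1" "j0 \<le> q0" "j1 \<le> q1" and k: "j \<le> k" "k \<le> T"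
    and T: "\<bar>x0\<bar> * q1 * T \<le> 1 / 4"
    and small: "\<bar>x0\<bar> \<le> 1" "\<bar>x1\<bar> < \<bar>x0\<bar>" "\<bar>x1\<bar> * q1 * T \<le> \<bar>x0\<bar> / 4"
    and y: "\<bar>y\<bar> \<le> \<bar>x0\<bar> / (4 * real q1 ^ 2)"
  shows "real q1 * y = real k * x1"
proof -
  have q1: "1 \<le> real q1" using q by simp
  have y1: "\<bar>y\<bar> * (real q1 * real q1) \<le> \<bar>x0\<bar> / 4"
    using y q1 by (simp add: field_simps power2_eq_square)
  have y2: "\<bar>y\<bar> * (real q0 * real q1) \<le> \<bar>x0\<bar> / 4"
    by (rule order_trans[OF _ y1]) (use q in \<open>intro mult_left_mono mult_right_mono; simp\<close>)
  have x1: "\<bar>x1\<bar> * (real q0 * real k) \<le> \<bar>x0\<bar> / 4"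
  proof -
    have "\<bar>x1\<bar> * (real q0 * real k) \<le> \<bar>x1\<bar> * (real q1 * real T)"
      using q k by (intro mult_left_mono mult_mono) auto
    with small(3) show ?thesis by (simp add: mult_ac)
  qed
  have x0: "\<bar>x0\<bar> * (real q1 * real k) \<le> 1 / 4"
  proof -
    have "\<bar>x0\<bar> * (real q1 * real k) \<le> \<bar>x0\<bar> * (real q1 * real T)"
      using k by (intro mult_left_mono mult_mono) auto
    with T show ?thesis by (simp add: mult_ac)
  qed
  let ?D = "real q1 * j - real k * j1"
  have "\<bar>det3 q0 j0 x0 q1 j1 x1 k j y\<bar>
    \<le> \<bar>x0\<bar> * (real q1 * real k) + \<bar>x1\<bar> * (real q0 * real k) + \<bar>y\<bar> * (real q0 * real q1)"
    by (rule det3_abs_le) (use q k in auto)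
  also have "\<dots> < 1" using x0 x1 y2 small(1) by linarith
  finally have "det3 q0 j0 x0 q1 j1 x1 k j y = 0"
    using det3_L_Ints[of q0 j0 m0 q1 j1 m1 k j m] Ints_nonzero_abs_less1
    unfolding x0_def x1_def y_def by blast
  \<comment> \<open>In the expansion of the vanishing determinant, \<open>x1\<close> and
    \<open>y\<close> contribute at most half of \<open>\<bar>x0\<bar>\<close>, which forces
    \<open>\<bar>?D\<bar> \<le> 1 / 2\<close>.\<close>
  then have "x0 * ?D = x1 * (real q0 * j - real k * j0) - y * (real q0 * j1 - real q1 * j0)"
    unfolding det3_def by linarith
  moreover have "\<bar>x1 * (real q0 * j - real k * j0)\<bar> \<le> \<bar>x1\<bar> * (real q0 * real k)"
    "\<bar>y * (real q0 * j1 - real q1 * j0)\<bar> \<le> \<bar>y\<bar> * (real q0 * real q1)"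
    using minor_abs_le q k by (auto simp: abs_mult intro!: mult_left_mono)
  ultimately have "\<bar>x0 * ?D\<bar> \<le> \<bar>x0\<bar> / 2" using x1 y2 by linarith
  moreover have "0 < \<bar>x0\<bar>" using small(2) by linarith
  ultimately have "\<bar>x0\<bar> * \<bar>?D\<bar> < \<bar>x0\<bar> * 1" unfolding abs_mult by linarith
  then have "\<bar>?D\<bar> < 1" using \<open>0 < \<bar>x0\<bar>\<close> by (simp only: mult_less_cancel_left_pos)
  moreover have "?D \<in> \<int>" by (intro Ints_diff Ints_mult) auto
  ultimately have "?D = 0" using Ints_nonzero_abs_less1 by blast
  then have "real q1 * y - real k * x1 \<in> \<int>"
    unfolding x1_def y_def by (intro minor_L_Ints) simp
  moreover have "\<bar>real q1 * y - real k * x1\<bar> < 1"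
  proof -
    have "\<bar>real q1 * y\<bar> \<le> \<bar>y\<bar> * (real q1 * real q1)"
      using q1 mult_left_mono[of 1 "real q1" "\<bar>y\<bar> * real q1"] by (simp add: abs_mult mult_ac)
    moreover have "\<bar>real k * x1\<bar> \<le> \<bar>x1\<bar> * (real q0 * real k)"
      using q mult_left_mono[of 1 "real q0" "\<bar>x1\<bar> * real k"] by (simp add: abs_mult mult_ac)
    ultimately show ?thesis using y1 x1 small(1) by linarith
  qed
  ultimately have "real q1 * y - real k * x1 = 0" using Ints_nonzero_abs_less1 by blast
  then show ?thesis by simp
qed

subsection \<open>Arithmetic progressions in the orbit\<close>

text \<open>The orbit times in a rich window number at most a global covering number times the size
  of one piece. Collinearity confines a piece to a short interval with separated points, where a
  second covering bound applies. The last inequality in \<open>large\<close> makes both bounds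
  together too small.\<close>

lemma no_independent_triple:
  fixes q0 j0 q1 j1 q2 j2 :: nat and m0 m1 m2 :: int and K :: real
  defines "x0 \<equiv> L q0 j0 m0" and "x1 \<equiv> L q1 j1 m1" and "x2 \<equiv> L q2 j2 m2"
  assumes q: "1 \<le> q0" "q0 < q1" "q1 < q2" "j0 \<le> q0" "j1 \<le> q1" "j2 \<le> q2"
    and dec: "\<bar>x1\<bar> < \<bar>x0\<bar>" "\<bar>x2\<bar> < \<bar>x1\<bar>"
    and sep: "\<And>k j m. 1 \<le> k \<Longrightarrow> k < q2 \<Longrightarrow> j \<le> k \<Longrightarrow> \<bar>x1\<bar> \<le> \<bar>L k j m\<bar>"
    and bound: "real q1 ^ 4 * \<bar>x0\<bar> \<le> K" "real q2 ^ 4 * \<bar>x1\<bar> \<le> K"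
    and large: "1 \<le> K" "16 * K ^ 2 \<le> q1" "4 * K < d * q1" "4096 * K ^ 2 < c ^ 4 * q1"
  shows "det3 q0 j0 x0 q1 j1 x1 q2 j2 x2 = 0"
proof (rule ccontr)
  assume det: "det3 q0 j0 x0 q1 j1 x1 q2 j2 x2 \<noteq> 0"
  define Q e0 e1 where "Q = real q1" and "e0 = \<bar>x0\<bar>" and "e1 = \<bar>x1\<bar>"
  have e1: "0 < e1" using dec(2) by (simp add: e1_def)
  have e01: "e1 < e0" using dec(1) by (simp add: e0_def e1_def)
  have e0: "0 < e0" using e1 e01 by simp
  have Q2: "Q < real q2" using q by (simp add: Q_def)
  have "K * 1 \<le> K ^ 2" using large(1) unfolding power2_eq_square by (intro mult_left_mono) auto
  then have QK: "16 * K \<le> Q" using large(2) by (simp add: Q_def)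
  have Q1: "1 \<le> Q" using QK large(1) by simp
  have b0: "Q ^ 4 * e0 \<le> K" and b1: "real q2 ^ 4 * e1 \<le> K"
    using bound by (simp_all add: Q_def e0_def e1_def)
  have e0Q: "e0 * Q \<le> 1 / 16"
  proof -
    have "16 * K \<le> Q ^ 3" using QK self_le_power[OF Q1, of 3] by simp
    then have "e0 * Q * (16 * K) \<le> e0 * Q * Q ^ 3"
      using e0 Q1 by (intro mult_left_mono) auto
    also have "\<dots> = Q ^ 4 * e0" by algebra
    also have "\<dots> \<le> K" by (rule b0)
    finally show ?thesis using large(1) by simp
  qed
  have e1q2: "e1 * real q2 ^ 2 \<le> 1 / 16"
  proof -
    have "real q2 \<le> real q2 ^ 2" using Q2 Q1 by (intro self_le_power) auto
    then have "16 * K \<le> real q2 ^ 2" using QK Q2 by linarith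
    then have "e1 * real q2 ^ 2 * (16 * K) \<le> e1 * real q2 ^ 2 * real q2 ^ 2"
      using e1 by (intro mult_left_mono) auto
    also have "\<dots> = real q2 ^ 4 * e1" by algebra
    also have "\<dots> \<le> K" by (rule b1)
    finally show ?thesis using large(1) by simp
  qed
  \<comment> \<open>A nonzero integer determinant is at least 1 in absolute value, and the terms of
    \<open>x1\<close> and \<open>x2\<close> are each at most 1/16. Hence \<open>q2\<close> exceeds
    the time scale \<open>T\<close> chosen below.\<close>
  have q2_large: "1 / 2 \<le> e0 * Q * real q2"
  proof -
    have "1 \<le> \<bar>det3 q0 j0 x0 q1 j1 x1 q2 j2 x2\<bar>"
      using det det3_L_Ints Ints_nonzero_abs_ge1 unfolding x0_def x1_def x2_def by blast
    also have "\<dots> \<le> \<bar>x0\<bar> * (real q1 * real q2) + \<bar>x1\<bar> * (real q0 * real q2)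
      + \<bar>x2\<bar> * (real q0 * real q1)"
      by (rule det3_abs_le) (use q in auto)
    also have "\<dots> \<le> \<bar>x0\<bar> * (real q1 * real q2) + \<bar>x1\<bar> * (real q2 * real q2)
      + \<bar>x1\<bar> * (real q2 * real q2)"
      using q dec(2) by (intro add_mono mult_mono) auto
    also have "\<dots> = e0 * Q * real q2 + 2 * (e1 * real q2 ^ 2)"
      by (simp add: e0_def e1_def Q_def power2_eq_square)
    finally show ?thesis using e1q2 by linarith
  qed
  \<comment> \<open>The lower bound on \<open>q2\<close> is inserted into its upper bound
    \<open>b1\<close>, and \<open>b0\<close> then eliminates the powers of \<open>Q\<close>.\<close>
  have "e1 \<le> e0 ^ 2"
  proof -
    have "(1 / 2) ^ 4 \<le> (e0 * Q * real q2) ^ 4" by (rule power_mono[OF q2_large]) simp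
    then have "e1 * 1 \<le> e1 * (16 * (e0 * Q * real q2) ^ 4)"
      using e1 by (intro mult_left_mono) (auto simp: power_divide)
    also have "\<dots> = 16 * (real q2 ^ 4 * e1) * (Q ^ 4 * e0) * e0 ^ 3"
      by algebra
    also have "\<dots> \<le> 16 * K * K * e0 ^ 3"
      using b0 b1 e0 e1 large(1) Q1 by (intro mult_right_mono mult_mono mult_left_mono) auto
    also have "\<dots> = (16 * K ^ 2) * e0 * e0 ^ 2" by algebra
    also have "\<dots> \<le> Q * e0 * e0 ^ 2"
      using large(2) e0 by (intro mult_right_mono) (auto simp: Q_def)
    also have "\<dots> \<le> 1 * e0 ^ 2"
      using e0Q by (intro mult_right_mono) (auto simp: mult.commute)
    finally show ?thesis by simp
  qed

  \<comment> \<open>The largest integer with \<open>e0 * Q * T \<le> 1 / 4\<close>, as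
    \<open>collinear_if_small\<close> requires; the floor loses at most a factor 2.\<close>
  define T where "T = nat \<lfloor>1 / (4 * (e0 * Q))\<rfloor>"
  have "0 < e0 * Q" using e0 Q1 by simp
  have T_ge4: "4 \<le> 1 / (4 * (e0 * Q))" using e0Q \<open>0 < e0 * Q\<close> by (simp add: field_simps)
  then have T_bounds: "real T \<le> 1 / (4 * (e0 * Q))" "1 / (4 * (e0 * Q)) < real T + 1"
    unfolding T_def by linarith+
  have T1: "1 \<le> T" using T_bounds T_ge4 by linarith
  have T_le: "e0 * Q * real T \<le> 1 / 4"
    using T_bounds(1) \<open>0 < e0 * Q\<close> by (simp add: field_simps)
  have "1 / (4 * (e0 * Q)) \<le> 2 * real T" using T_bounds(2) T1 by linarith
  then have T_ge: "1 \<le> 8 * (e0 * Q * real T)"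
    using \<open>0 < e0 * Q\<close> by (simp add: field_simps)
  have "e0 * Q * real T < e0 * Q * real q2" using T_le q2_large by linarith
  then have T_less: "T < q2"
    using mult_less_cancel_left_pos[OF \<open>0 < e0 * Q\<close>] by simp
  have e1T: "e1 * Q * real T \<le> e0 / 4"
  proof -
    have "e0 * (e1 * Q * real T) = e1 * (e0 * Q * real T)" by simp
    also have "\<dots> \<le> e0 ^ 2 * (1 / 4)"
      using \<open>e1 \<le> e0 ^ 2\<close> T_le e0 Q1 by (intro mult_mono) auto
    also have "\<dots> = e0 * (e0 / 4)" by (simp add: power2_eq_square)
    finally show ?thesis using e0 by simp
  qed
  \<comment> \<open>This keeps both scales used below, \<open>\<rho>\<close> and
    \<open>\<delta>\<close>, under the threshold \<open>d\<close>.\<close>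
  have e0Q3: "4 * (e0 * Q ^ 3) < d"
  proof -
    have "4 * (e0 * Q ^ 3) * Q = 4 * (Q ^ 4 * e0)" by algebra
    also have "\<dots> \<le> 4 * K" using b0 by simp
    also have "\<dots> < d * Q" using large(3) by (simp add: Q_def)
    finally show ?thesis using Q1 by simp
  qed
  have Q_pow: "e0 * 1 \<le> e0 * Q ^ 3" "e0 * Q ^ 2 \<le> e0 * Q ^ 3"
    using e0 Q1 by (auto intro!: mult_left_mono power_increasing simp: one_le_power)

  define \<rho> where "\<rho> = e0 / (4 * Q ^ 2)"
  have \<rho>: "0 < \<rho>" using e0 Q1 by (simp add: \<rho>_def)
  have "\<rho> \<le> e0 / 1"
    unfolding \<rho>_def using e0 one_le_power[OF Q1, of 2] by (intro divide_left_mono) auto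
  then have \<rho>d: "\<rho> < d" using Q_pow(1) e0Q3 e0 by linarith

  obtain a where a: "c * real T \<le> real (card ({a<..a + T} \<inter> A))" using window[OF T1] by blast
  let ?G = "{a<..a + T} \<inter> A"
  obtain G' where G': "G' \<subseteq> ?G" "card ?G \<le> covering_number (t ` A) \<rho> * card G'"
    "\<And>n n'. n \<in> G' \<Longrightarrow> n' \<in> G' \<Longrightarrow> \<bar>t n - t n'\<bar> \<le> \<rho>"
    using covering_number_pigeonhole[of ?G t "t ` A" \<rho>, OF _ _ bounded_orbit \<rho>]
    by (metis finite_Int finite_greaterThanAtMost image_mono inf_le2)
  have fin: "finite G'" using G'(1) by (rule finite_subset) simp
  have "0 < c * real T" using c_pos T1 by simp
  then have "G' \<noteq> {}" using G'(2) a by auto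

  \<comment> \<open>Differences within a piece have absolute value \<open>k * e1 / Q\<close> with
    \<open>k < T\<close>, hence are at most \<open>l\<close>. As \<open>T < q2\<close>, they are
    also at least \<open>e1\<close>.\<close>
  define l where "l = e1 * real T / Q"
  have l: "0 < l" using e1 T1 Q1 by (simp add: l_def)
  have dist: "e1 \<le> \<bar>t n - t n'\<bar> \<and> \<bar>t n - t n'\<bar> \<le> l"
    if n: "n \<in> G'" "n' \<in> G'" "n \<noteq> n'" for n n'
  proof -
    have "n \<in> ?G" "n' \<in> ?G" using n G'(1) by blast+
    then have "\<exists>k j m. 1 \<le> k \<and> k < T \<and> j \<le> k \<and> \<bar>t n - t n'\<bar> = \<bar>L k j m\<bar>"
      using n(3) by (intro abs_t_diff) auto
    then obtain k j m where k: "1 \<le> k" "k < T" "j \<le> k" "\<bar>t n - t n'\<bar> = \<bar>L k j m\<bar>"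
      by blast
    have "real q1 * L k j m = real k * L q1 j1 m1"
    proof (rule collinear_if_small[where T = T])
      show "\<bar>L q0 j0 m0\<bar> * real q1 * real T \<le> 1 / 4" using T_le
        by (simp add: e0_def Q_def x0_def)
      have "e0 * 1 \<le> e0 * Q" using Q1 e0 by (intro mult_left_mono) auto
      then have "e0 \<le> 1" using e0Q by linarith
      then show "\<bar>L q0 j0 m0\<bar> \<le> 1" by (simp add: e0_def x0_def)
      show "\<bar>L q1 j1 m1\<bar> * real q1 * real T \<le> \<bar>L q0 j0 m0\<bar> / 4" using e1T
        by (simp add: e0_def e1_def Q_def x0_def x1_def)
      show "\<bar>L k j m\<bar> \<le> \<bar>L q0 j0 m0\<bar> / (4 * real q1 ^ 2)"
        using G'(3)[OF n(1,2)] k(4) by (simp add: \<rho>_def e0_def Q_def x0_def)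
    qed (use q k dec in \<open>auto simp: x0_def x1_def\<close>)
    then have "\<bar>real q1 * L k j m\<bar> = \<bar>real k * L q1 j1 m1\<bar>" by simp
    then have "Q * \<bar>t n - t n'\<bar> = real k * e1"
      by (simp add: abs_mult k(4) Q_def e1_def x1_def)
    also have "\<dots> \<le> real T * e1" using k e1 by simp
    finally have "\<bar>t n - t n'\<bar> \<le> l" using Q1 by (simp add: l_def field_simps)
    moreover have "e1 \<le> \<bar>t n - t n'\<bar>"
      unfolding k(4) e1_def using k T_less by (intro sep) auto
    ultimately show ?thesis by blast
  qed
  define u where "u = Min (t ` G')"
  have "u \<in> t ` G'" unfolding u_def using fin \<open>G' \<noteq> {}\<close> by (intro Min_in) auto
  then obtain n0 where n0: "n0 \<in> G'" "u = t n0" by blast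
  have in_I: "t n \<in> {u..u + l}" if "n \<in> G'" for n
  proof -
    have "u \<le> t n" unfolding u_def using fin that by simp
    moreover have "t n \<le> u + l"
      using dist[OF that n0(1)] l n0(2) by (cases "n = n0") auto
    ultimately show ?thesis by simp
  qed
  \<comment> \<open>Chosen so that \<open>\<delta> * l\<close> is half the separation
    \<open>e1\<close>.\<close>
  define \<delta> where "\<delta> = Q / (2 * real T)"
  have \<delta>: "0 < \<delta>" using Q1 T1 by (simp add: \<delta>_def)
  have \<delta>l: "\<delta> * l = e1 / 2" using Q1 T1 by (simp add: \<delta>_def l_def)
  have "Q * 1 \<le> Q * (8 * (e0 * Q * real T))" using T_ge Q1 by (intro mult_left_mono) auto
  then have "\<delta> \<le> 4 * (e0 * Q ^ 2)"
    using T1 by (simp add: \<delta>_def pos_divide_le_eq power2_eq_square mult_ac)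
  then have \<delta>d: "\<delta> < d" using e0Q3 Q_pow(2) by linarith
  have "card G' \<le> covering_number (t ` A \<inter> {u..u + l}) (\<delta> * l)"
  proof (rule card_le_covering_number[where f = t])
    show "t ` G' \<subseteq> t ` A \<inter> {u..u + l}" using in_I G'(1) by blast
    show "\<delta> * l < \<bar>t n - t n'\<bar>" if "n \<in> G'" "n' \<in> G'" "n \<noteq> n'" for n n'
      using dist[OF that] e1 unfolding \<delta>l by linarith
  qed (use fin bounded_orbit \<delta> l in \<open>auto intro: bounded_subset\<close>)
  then have "real (card G') ^ 4 \<le> real (covering_number (t ` A \<inter> {u..u + l}) (\<delta> * l)) ^ 4"
    by (intro power_mono) auto
  also have "\<dots> \<le> 1 / \<delta>"
    using interval_of_length_Icc[of u "u + l"] l by (intro covering_small[OF \<delta> \<delta>d]) auto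
  finally have card_G': "real (card G') ^ 4 \<le> 2 * real T / Q" by (simp add: \<delta>_def)

  \<comment> \<open>The global bound at scale \<open>\<rho>\<close> and the local bound on
    \<open>card G'\<close> are multiplied as fourth powers.\<close>
  have "c * real T \<le> real (covering_number (t ` A) \<rho>) * real (card G')"
    using a G'(2) by (metis of_nat_le_iff of_nat_mult order_trans)
  then have "(c * real T) ^ 4 \<le> (real (covering_number (t ` A) \<rho>) * real (card G')) ^ 4"
    using c_pos by (intro power_mono) auto
  also have "\<dots> \<le> 1 / \<rho> * (2 * real T / Q)"
    unfolding power_mult_distrib using covering_orbit[OF \<rho> \<rho>d] card_G' \<rho>
    by (intro mult_mono) auto
  also have "\<dots> = 8 * Q * real T / e0"
    using Q1 by (simp add: \<rho>_def power2_eq_square)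
  finally have "c ^ 4 * real T ^ 4 * e0 \<le> 8 * Q * real T"
    using e0 by (simp add: pos_le_divide_eq power_mult_distrib)
  moreover have "c ^ 4 * real T ^ 4 * e0 = real T * (c ^ 4 * real T ^ 3 * e0)" by algebra
  ultimately have "real T * (c ^ 4 * real T ^ 3 * e0) \<le> real T * (8 * Q)"
    by (simp only: mult_ac)
  then have main: "c ^ 4 * real T ^ 3 * e0 \<le> 8 * Q" using T1 by simp
  \<comment> \<open>The lower bound on \<open>T\<close> removes \<open>T\<close> from
    \<open>main\<close>; then \<open>b0\<close> removes \<open>e0\<close> and leaves an inequality
    between powers of \<open>Q\<close> that fails for large \<open>Q\<close>.\<close>
  have "c ^ 4 * 1 \<le> c ^ 4 * (8 * (e0 * Q * real T)) ^ 3"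
    using T_ge by (intro mult_left_mono one_le_power) auto
  also have "\<dots> = 512 * e0 ^ 2 * Q ^ 3 * (c ^ 4 * real T ^ 3 * e0)"
    by algebra
  also have "\<dots> \<le> 512 * e0 ^ 2 * Q ^ 3 * (8 * Q)"
    using main Q1 by (intro mult_left_mono) auto
  finally have "c ^ 4 * Q ^ 4 \<le> 512 * e0 ^ 2 * Q ^ 3 * (8 * Q) * Q ^ 4"
    using Q1 by (intro mult_right_mono) auto
  also have "\<dots> = 4096 * (Q ^ 4 * e0) ^ 2" by algebra
  also have "\<dots> \<le> 4096 * K ^ 2" using b0 e0 Q1 by (intro mult_left_mono power_mono) auto
  also have "\<dots> < c ^ 4 * Q" using large(4) by (simp add: Q_def)
  also have "\<dots> \<le> c ^ 4 * Q ^ 4" using Q1 by (intro mult_left_mono self_le_power) auto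
  finally show False by simp
qed

text \<open>Independent triples occur arbitrarily late, hence also with a middle index
  \<open>q (Suc i)\<close> beyond every threshold of \<open>no_independent_triple\<close>.\<close>

lemma inconsistent: False
proof -
  obtain q j :: "nat \<Rightarrow> nat" and m :: "nat \<Rightarrow> int" where seq:
    "\<And>i. 1 \<le> q i" "\<And>i. j i \<le> q i" "\<And>i. q i < q (Suc i)"
    "\<And>i. \<bar>L (q (Suc i)) (j (Suc i)) (m (Suc i))\<bar> < \<bar>L (q i) (j i) (m i)\<bar>"
    "\<And>i k j' m'. 1 \<le> k \<Longrightarrow> k < q (Suc i) \<Longrightarrow> j' \<le> k \<Longrightarrow> \<bar>L (q i) (j i) (m i)\<bar> \<le> \<bar>L k j' m'\<bar>"
    using ex_best_approximations by metis
  obtain K T0 where K: "1 \<le> K" "\<And>T \<delta>. T0 \<le> T \<Longrightarrow> 0 < \<delta> \<Longrightarrow>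
      (\<And>k j m. 1 \<le> k \<Longrightarrow> k < T \<Longrightarrow> j \<le> k \<Longrightarrow> \<delta> \<le> \<bar>L k j m\<bar>) \<Longrightarrow> real T ^ 4 * \<delta> \<le> K"
    using separation_bound by metis
  have q_ge: "i \<le> q i" for i
    by (induction i) (use seq(3) in \<open>auto simp: Suc_le_eq intro: le_less_trans\<close>)
  have bound: "real (q (Suc i)) ^ 4 * \<bar>L (q i) (j i) (m i)\<bar> \<le> K" if "T0 \<le> i" for i
  proof (rule K(2))
    show "T0 \<le> q (Suc i)" using that q_ge[of "Suc i"] by linarith
    show "0 < \<bar>L (q i) (j i) (m i)\<bar>" using seq(4)[of i] by linarith
  qed (use seq(5) in auto)
  \<comment> \<open>The three summands are nonnegative, so one \<open>B\<close> dominates each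
    threshold.\<close>
  obtain B :: nat where B: "16 * K ^ 2 + 4 * K / d + 4096 * K ^ 2 / c ^ 4 < real B"
    using reals_Archimedean2 by blast
  obtain i where i: "max T0 B \<le> i" "det3 (q i) (j i) (L (q i) (j i) (m i))
      (q (Suc i)) (j (Suc i)) (L (q (Suc i)) (j (Suc i)) (m (Suc i)))
      (q (Suc (Suc i))) (j (Suc (Suc i))) (L (q (Suc (Suc i))) (j (Suc (Suc i))) (m (Suc (Suc i)))) \<noteq> 0"
    using infinitely_many_independent_triples[of q j m T0 K "max T0 B", OF seq(1-4) bound] by blast
  have Q: "real B \<le> real (q (Suc i))" using i(1) q_ge[of "Suc i"] by simp
  have nonneg: "0 \<le> 16 * K ^ 2" "0 \<le> 4 * K / d" "0 \<le> 4096 * K ^ 2 / c ^ 4"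
    using K(1) d c_pos by auto
  have large: "16 * K ^ 2 \<le> q (Suc i)" "4 * K / d < q (Suc i)" "4096 * K ^ 2 / c ^ 4 < q (Suc i)"
    using B Q nonneg by linarith+
  have large': "4 * K < d * q (Suc i)" "4096 * K ^ 2 < c ^ 4 * q (Suc i)"
    using large(2,3) d(1) c_pos by (simp_all add: pos_divide_less_eq mult.commute)
  have "T0 \<le> i" "T0 \<le> Suc i" using i(1) by auto
  note bounds = this[THEN bound]
  have "det3 (q i) (j i) (L (q i) (j i) (m i))
      (q (Suc i)) (j (Suc i)) (L (q (Suc i)) (j (Suc i)) (m (Suc i)))
      (q (Suc (Suc i))) (j (Suc (Suc i))) (L (q (Suc (Suc i))) (j (Suc (Suc i))) (m (Suc (Suc i)))) = 0"
    by (rule no_independent_triple[where K = K])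
      (rule seq bounds K(1) large(1) large'; assumption)+
  with i(2) show False by contradiction
qed

end

section \<open>Application to orbits\<close>

text \<open>Here \<open>j\<close> counts the steps by \<beta> among the \<open>k\<close> steps, and
  \<open>m\<close> collects the reductions modulo 1.\<close>

lemma orbit_diff:
  assumes "alpha_beta_orbit \<alpha> \<beta> t" "1 \<le> n"
  shows "\<exists>j\<le>k. \<exists>m::int. t (n + k) - t n = real k * \<alpha> + real j * (\<beta> - \<alpha>) - m"
proof (induction k)
  case (Suc k)
  then obtain j m where jm: "j \<le> k" "t (n + k) - t n = real k * \<alpha> + real j * (\<beta> - \<alpha>) - real_of_int m"
    by blast
  have "[t (Suc (n + k)) - t (n + k) = \<alpha>] (rmod 1) \<or> [t (Suc (n + k)) - t (n + k) = \<beta>] (rmod 1)"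
    using assms by (simp add: alpha_beta_orbit_def)
  then consider z :: int where "t (n + Suc k) = t (n + k) + \<alpha> - z"
    | z :: int where "t (n + Suc k) = t (n + k) + \<beta> - z"
    unfolding rcong_altdef by (fastforce simp: algebra_simps)
  then show ?case
  proof cases
    case (1 z)
    then have "t (n + Suc k) - t n = real (Suc k) * \<alpha> + real j * (\<beta> - \<alpha>) - real_of_int (m + z)"
      using jm(2) by (simp add: algebra_simps)
    then show ?thesis using jm(1) by (meson le_Suc_eq)
  next
    case (2 z)
    then have "t (n + Suc k) - t n = real (Suc k) * \<alpha> + real (Suc j) * (\<beta> - \<alpha>) - real_of_int (m + z)"
      using jm(2) by (simp add: algebra_simps)
    then show ?thesis using jm(1) by (meson Suc_le_mono)
  qed
qed (auto intro!: exI[of _ 0])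

theorem theorem1p5:
  fixes \<alpha> \<beta> :: real and t :: "nat \<Rightarrow> real" and J :: "nat set"
  assumes "rat_independent_with_1 \<alpha> \<beta>"
    and "alpha_beta_orbit \<alpha> \<beta> t"
    and "J \<subseteq> {1..}"
    and "lower_density J < 1"
  shows "assouad_dim (t ` ({1..} - J)) \<ge> 1 / 4"
proof (rule ccontr)
  assume "\<not> ?thesis"
  then have "assouad_dim (t ` ({1..} - J)) < 1 / 4" by simp
  then obtain d where d: "0 < d" "d < 1"
    "\<And>\<delta> l I. 0 < \<delta> \<Longrightarrow> \<delta> < d \<Longrightarrow> l > 0 \<Longrightarrow> interval_of_length l I \<Longrightarrow>
       real (covering_number (t ` ({1..} - J) \<inter> I) (\<delta> * l)) ^ 4 \<le> 1 / \<delta>"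
    using assouad_dim_lessD by metis
  obtain c where c: "0 < c"
    "\<And>L. L \<ge> 1 \<Longrightarrow> \<exists>a. c * real L \<le> real (card ({a<..a + L} - J))"
    using windows_of_lower_density_less_1[OF assms(4)] by metis
  have "low_dimensional_orbit \<alpha> (\<beta> - \<alpha>) t ({1..} - J) c d"
  proof
    fix n n' :: nat
    assume n: "n \<in> {1..} - J"
    then show "t n \<in> {0..<1}" using assms(2) by (simp add: alpha_beta_orbit_def)
    assume "n < n'"
    then show "\<exists>j\<le>n' - n. \<exists>m. t n' - t n = real (n' - n) * \<alpha> + real j * (\<beta> - \<alpha>) - real_of_int m"
      using orbit_diff[OF assms(2), of n "n' - n"] n by simp
  next
    fix k j :: nat and m :: int
    assume k: "1 \<le> k" "j \<le> k"
    show "real k * \<alpha> + real j * (\<beta> - \<alpha>) - real_of_int m \<noteq> 0"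
    proof
      assume "real k * \<alpha> + real j * (\<beta> - \<alpha>) - real_of_int m = 0"
      \<comment> \<open>Regrouped in terms of \<alpha> and \<beta>, a zero of \<open>L\<close>
        forces \<open>j = 0\<close> and \<open>k = j\<close>, against
        \<open>1 \<le> k\<close>.\<close>
      then have "of_int (int k - int j) * \<alpha> + of_int (int j) * \<beta> = of_int m"
        by (simp add: algebra_simps)
      from rat_independent_with_1_imp[OF assms(1) this] show False using k by simp
    qed
  next
    fix T :: nat
    assume "1 \<le> T"
    \<comment> \<open>A window \<open>{a<..a + T}\<close> omits 0 even for \<open>a = 0\<close>, so
      it contains only valid times.\<close>
    moreover have "{a<..a + T} - J = {a<..a + T} \<inter> ({1..} - J)" for a by auto
    ultimately show "\<exists>a. c * real T \<le> real (card ({a<..a + T} \<inter> ({1..} - J)))"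
      using c(2)[of T] by simp
  qed (use c(1) d in auto)
  then show False by (rule low_dimensional_orbit.inconsistent)
qed

end
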